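(* Let $s>3/2$ and let $u_0\in G^{1,s}(\mathbb{R})$ be such that the initial momentum $m_0(x):=u_0(x)-u_0''(x)$ belongs to $L^1(\mathbb{R})$ and is positive on $\mathbb{R}$. Let $u\in C^{\omega}([0,\infty)\times\mathbb{R})$ be the unique global analytic solution of $$u_t=\partial_x (u^2)+\partial_x\Lambda^{-2}\left(u^2+\partial_x (u^2)\right),\qquad u(0,x)=u_0(x).$$ Then for any $\epsilon>0$ the solution $u$ endows the strip $\mathcal{S}=(0,\epsilon)\times\mathbb{R}$ with the analytic metric $$\begin{aligned} g=&\left[(u-u_{xx})^2+\left(\mu(u-u_{xx})\pm m_1\sqrt{1+\mu^2}\right)^2\right]dx^2\\ &+2\left(2u(u-u_{xx})+\psi\right)\left[(1+\mu^2)(u-u_{xx})\pm m_1\mu\sqrt{1+\mu^2}\right]dx\,dt\\ &+(1+\mu^2)\left(2u(u-u_{xx})+\psi\right)^2dt^2,\qquad \psi=\frac{4}{m_1}uu_x-2u_x^2-2u^2, \end{aligned}$$ where $\mu\in\mathbb{R}$ and $m_1\in\{-2,1\}$ are arbitrary (with either consistent choice of the sign $\pm$). That is, $u$ is a generic solution on $\mathcal{S}$, and the coefficients of $g$ are real analytic functions on $\mathcal{S}$.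
   Context: All functions are real valued. Fourier transform: $\hat u(\xi)=\frac{1}{\sqrt{2\pi}}\int_{\mathbb{R}}e^{-ix\xi}u(x)\,dx$. For $\sigma>0$, $s\in\mathbb{R}$, the Gevrey space $G^{\sigma,s}(\mathbb{R})$ is the set of $u\in L^2(\mathbb{R})$ with $\|u\|_{G^{\sigma,s}}:=\left(\int_{\mathbb{R}}e^{2\sigma|\xi|}(1+|\xi|^2)^s|\hat u(\xi)|^2d\xi\right)^{1/2}<\infty$. $\Lambda^{-2}$ is the inverse of $\Lambda^2=1-\partial_x^2$, given by $\Lambda^{-2}\varphi=\frac12e^{-|x|}*\varphi$. The solution $u$ is the unique solution in $C([0,\infty),H^s(\mathbb{R}))$; under the stated hypotheses on $u_0$ it exists globally and is jointly real analytic, $u\in C^\omega([0,\infty)\times\mathbb{R})$. Associated one-forms: for $\mu\in\mathbb{R}$, $m_1\in\{-2,1\}$ and a choice of sign, set $\omega_i=f_{i1}dx+f_{i2}dt$, $i=1,2$, with $$f_{11}=u-u_{xx},\qquad f_{12}=2u(u-u_{xx})+\frac{4}{m_1}uu_x-2u_x^2-2u^2,$$ $$f_{21}=\mu(u-u_{xx})\pm m_1\sqrt{1+\mu^2},\qquad f_{22}=\mu f_{12}.$$ The metric is $g=\omega_1^2+\omega_2^2$. Generic solutions: a solution $u$ is nongeneric on $\mathcal{S}$ if $\omega_1\wedge\omega_2$ vanishes identically on $\mathcal{S}$, and generic on $\mathcal{S}$ otherwise, i.e. if $\omega_1\wedge\omega_2\not\equiv0$ on $\mathcal{S}$. A solution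 endows $\mathcal{S}$ with the metric $g$ when it is generic on $\mathcal{S}$. *)

theory Defs
  imports "HOL-Analysis.Analysis"
begin

section \<open>Fourier transform on L2, Gevrey and Sobolev spaces\<close>

definition L2_real :: "(real \<Rightarrow> real) set" where
  "L2_real = {u \<in> borel_measurable lborel. integrable lborel (\<lambda>x. (u x)\<^sup>2)}"

definition truncated_fourier :: "real \<Rightarrow> (real \<Rightarrow> real) \<Rightarrow> real \<Rightarrow> complex" where
  "truncated_fourier R u \<xi> =
     complex_of_real (1 / sqrt (2 * pi)) *
     (LBINT x:{-R..R}. exp (- (\<i> * complex_of_real (x * \<xi>))) * complex_of_real (u x))"

text \<open>An element of L2 need not be integrable, so its transform is the L2 limit of the transforms
  of its truncations (Plancherel).  The limit exists for every element of L2 and is unique up to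
  null sets; the norms below do not depend on the representative that is chosen.\<close>

definition is_fourier_L2 :: "(real \<Rightarrow> real) \<Rightarrow> (real \<Rightarrow> complex) \<Rightarrow> bool" where
  "is_fourier_L2 u v \<longleftrightarrow>
     v \<in> borel_measurable lborel \<and>
     ((\<lambda>R. \<integral>\<^sup>+ \<xi>. ennreal ((cmod (truncated_fourier R u \<xi> - v \<xi>))\<^sup>2) \<partial>lborel)
        \<longlongrightarrow> 0) at_top"

definition fourier :: "(real \<Rightarrow> real) \<Rightarrow> real \<Rightarrow> complex" where
  "fourier u = (SOME v. is_fourier_L2 u v)"

definition gevrey_density :: "real \<Rightarrow> real \<Rightarrow> (real \<Rightarrow> real) \<Rightarrow> real \<Rightarrow> real" where
  "gevrey_density \<sigma> s u \<xi> =
     exp (2 * \<sigma> * \<bar>\<xi>\<bar>) * (1 + \<xi>\<^sup>2) powr s * (cmod (fourier u \<xi>))\<^sup>2"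

definition gevrey_norm :: "real \<Rightarrow> real \<Rightarrow> (real \<Rightarrow> real) \<Rightarrow> real" where
  "gevrey_norm \<sigma> s u = sqrt (LBINT \<xi>. gevrey_density \<sigma> s u \<xi>)"

definition gevrey_space :: "real \<Rightarrow> real \<Rightarrow> (real \<Rightarrow> real) set" where
  "gevrey_space \<sigma> s = {u \<in> L2_real. integrable lborel (gevrey_density \<sigma> s u)}"

text \<open>For \<open>\<sigma> = 0\<close> the weight reduces to the Sobolev weight.  As a subset of L2 this is the
  usual Sobolev space only for \<open>s \<ge> 0\<close>.\<close>

definition sobolev_norm :: "real \<Rightarrow> (real \<Rightarrow> real) \<Rightarrow> real" where
  "sobolev_norm s = gevrey_norm 0 s"

definition sobolev_space :: "real \<Rightarrow> (real \<Rightarrow> real) set" where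
  "sobolev_space s = gevrey_space 0 s"

section \<open>Real analytic functions of two variables\<close>

definition real_analytic_at :: "(real \<times> real \<Rightarrow> real) \<Rightarrow> real \<times> real \<Rightarrow> bool" where
  "real_analytic_at f p \<longleftrightarrow>
     (\<exists>(a :: nat \<times> nat \<Rightarrow> real) r. r > 0 \<and>
        (\<forall>h k. \<bar>h\<bar> < r \<longrightarrow> \<bar>k\<bar> < r \<longrightarrow>
           ((\<lambda>(i, j). a (i, j) * h ^ i * k ^ j) has_sum f (fst p + h, snd p + k)) UNIV))"

text \<open>On a set that is not open, such as a closed half plane, analyticity means that the function
  is the restriction of an analytic function on an open neighbourhood; for open sets this is
  analyticity at every point.\<close>

definition real_analytic_on :: "(real \<times> real \<Rightarrow> real) \<Rightarrow> (real \<times> real) set \<Rightarrow> bool" where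
  "real_analytic_on f S \<longleftrightarrow>
     (\<exists>U F. open U \<and> S \<subseteq> U \<and> (\<forall>p\<in>U. real_analytic_at F p) \<and> (\<forall>p\<in>S. F p = f p))"

section \<open>The equation\<close>

text \<open>Points of the plane are pairs \<open>(t, x)\<close>, with time first.\<close>

definition Lambda_inv2 :: "(real \<Rightarrow> real) \<Rightarrow> real \<Rightarrow> real" where
  "Lambda_inv2 \<phi> x = 1 / 2 * (LBINT y. exp (- \<bar>x - y\<bar>) * \<phi> y)"

definition momentum :: "(real \<Rightarrow> real) \<Rightarrow> real \<Rightarrow> real" where
  "momentum v x = v x - deriv (deriv v) x"

text \<open>Solutions in \<open>C([0,\<infinity>), H\<^sup>s)\<close>.  The time derivative is one-sided at \<open>t = 0\<close>.\<close>

definition global_solution ::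
    "real \<Rightarrow> (real \<Rightarrow> real) \<Rightarrow> (real \<times> real \<Rightarrow> real) \<Rightarrow> bool" where
  "global_solution s u\<^sub>0 u \<longleftrightarrow>
     (\<forall>t\<ge>0. (\<lambda>x. u (t, x)) \<in> sobolev_space s) \<and>
     (\<forall>t\<ge>0. ((\<lambda>\<tau>. sobolev_norm s (\<lambda>x. u (\<tau>, x) - u (t, x))) \<longlongrightarrow> 0) (at t within {0..})) \<and>
     (\<forall>t\<ge>0. \<forall>x.
        ((\<lambda>\<tau>. u (\<tau>, x)) has_real_derivative
           (deriv (\<lambda>y. (u (t, y))\<^sup>2) x
            + deriv (Lambda_inv2 (\<lambda>y. (u (t, y))\<^sup>2 + deriv (\<lambda>z. (u (t, z))\<^sup>2) y)) x))
          (at t within {0..})) \<and>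
     (\<forall>x. u (0, x) = u\<^sub>0 x)"

section \<open>One-forms and the associated metric\<close>

definition pdx :: "(real \<times> real \<Rightarrow> real) \<Rightarrow> real \<times> real \<Rightarrow> real" where
  "pdx u = (\<lambda>(t, x). deriv (\<lambda>y. u (t, y)) x)"

text \<open>A one-form maps a point and a tangent vector to a number, a bilinear form maps a point and
  two tangent vectors to a number.  Tangent vectors have components \<open>(\<partial>\<^sub>t, \<partial>\<^sub>x)\<close>.\<close>

type_synonym one_form = "real \<times> real \<Rightarrow> real \<times> real \<Rightarrow> real"
type_synonym bilinear_form = "real \<times> real \<Rightarrow> real \<times> real \<Rightarrow> real \<times> real \<Rightarrow> real"

definition dx :: "real \<times> real \<Rightarrow> real" where "dx v = snd v"
definition dt :: "real \<times> real \<Rightarrow> real" where "dt v = fst v"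

definition wedge :: "one_form \<Rightarrow> one_form \<Rightarrow> bilinear_form" where
  "wedge \<alpha> \<beta> p v w = \<alpha> p v * \<beta> p w - \<alpha> p w * \<beta> p v"

text \<open>The parameter \<open>\<delta>\<close> is the sign, \<open>1\<close> or \<open>-1\<close>, in front of \<open>m\<^sub>1 * sqrt (1 + \<mu>\<^sup>2)\<close>.\<close>

definition f11 :: "(real \<times> real \<Rightarrow> real) \<Rightarrow> real \<times> real \<Rightarrow> real" where
  "f11 u p = u p - pdx (pdx u) p"

definition f12 :: "real \<Rightarrow> (real \<times> real \<Rightarrow> real) \<Rightarrow> real \<times> real \<Rightarrow> real" where
  "f12 m\<^sub>1 u p = 2 * u p * (u p - pdx (pdx u) p) + 4 / m\<^sub>1 * u p * pdx u p
                - 2 * (pdx u p)\<^sup>2 - 2 * (u p)\<^sup>2"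

definition f21 ::
    "real \<Rightarrow> real \<Rightarrow> real \<Rightarrow> (real \<times> real \<Rightarrow> real) \<Rightarrow> real \<times> real \<Rightarrow> real" where
  "f21 \<mu> m\<^sub>1 \<delta> u p = \<mu> * (u p - pdx (pdx u) p) + \<delta> * m\<^sub>1 * sqrt (1 + \<mu>\<^sup>2)"

definition f22 :: "real \<Rightarrow> real \<Rightarrow> (real \<times> real \<Rightarrow> real) \<Rightarrow> real \<times> real \<Rightarrow> real" where
  "f22 \<mu> m\<^sub>1 u p = \<mu> * f12 m\<^sub>1 u p"

definition omega1 :: "real \<Rightarrow> (real \<times> real \<Rightarrow> real) \<Rightarrow> one_form" where
  "omega1 m\<^sub>1 u p v = f11 u p * dx v + f12 m\<^sub>1 u p * dt v"

definition omega2 :: "real \<Rightarrow> real \<Rightarrow> real \<Rightarrow> (real \<times> real \<Rightarrow> real) \<Rightarrow> one_form" where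
  "omega2 \<mu> m\<^sub>1 \<delta> u p v = f21 \<mu> m\<^sub>1 \<delta> u p * dx v + f22 \<mu> m\<^sub>1 u p * dt v"

definition induced_metric :: "real \<Rightarrow> real \<Rightarrow> real \<Rightarrow> (real \<times> real \<Rightarrow> real) \<Rightarrow> bilinear_form" where
  "induced_metric \<mu> m\<^sub>1 \<delta> u p v w =
     omega1 m\<^sub>1 u p v * omega1 m\<^sub>1 u p w + omega2 \<mu> m\<^sub>1 \<delta> u p v * omega2 \<mu> m\<^sub>1 \<delta> u p w"

definition nongeneric_on ::
    "real \<Rightarrow> real \<Rightarrow> real \<Rightarrow> (real \<times> real \<Rightarrow> real) \<Rightarrow> (real \<times> real) set \<Rightarrow> bool" where
  "nongeneric_on \<mu> m\<^sub>1 \<delta> u S \<longleftrightarrow>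
     (\<forall>p\<in>S. \<forall>v w. wedge (omega1 m\<^sub>1 u) (omega2 \<mu> m\<^sub>1 \<delta> u) p v w = 0)"

definition generic_on ::
    "real \<Rightarrow> real \<Rightarrow> real \<Rightarrow> (real \<times> real \<Rightarrow> real) \<Rightarrow> (real \<times> real) set \<Rightarrow> bool" where
  "generic_on \<mu> m\<^sub>1 \<delta> u S \<longleftrightarrow> \<not> nongeneric_on \<mu> m\<^sub>1 \<delta> u S"

text \<open>\<open>E dx\<^sup>2 + 2 F dx dt + G dt\<^sup>2\<close> as a symmetric bilinear form.\<close>

definition quadratic_metric ::
    "(real \<times> real \<Rightarrow> real) \<Rightarrow> (real \<times> real \<Rightarrow> real) \<Rightarrow> (real \<times> real \<Rightarrow> real) \<Rightarrow> bilinear_form" where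
  "quadratic_metric E F G p v w =
     E p * dx v * dx w + F p * (dx v * dt w + dt v * dx w) + G p * dt v * dt w"

end

theory Submission
  imports Defs
begin

text \<open>The wedge product of the two forms is a nonzero constant multiple of
  \<open>f\<^sub>1\<^sub>2 dx \<and> dt\<close>, because the multiple \<open>\<mu>\<close> of \<open>\<omega>\<^sub>1\<close> contained in \<open>\<omega>\<^sub>2\<close> cancels.
  So a nongeneric solution satisfies \<open>f\<^sub>1\<^sub>2 = 0\<close> on the strip.  Written out, the terms in
  \<open>u\<^sup>2\<close> cancel, and the equation becomes
  \<open>(u\<^sup>2)\<^sub>x\<^sub>x = (2 / m\<^sub>1) (u\<^sup>2)\<^sub>x\<close> at each fixed time.  Hence \<open>(u\<^sup>2)\<^sub>x\<close> is a
  multiple of an exponential and keeps its sign, so \<open>u\<^sup>2\<close> is monotone in \<open>x\<close>.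
  A monotone nonnegative integrable function on the line is zero, and \<open>u(t, \<cdot>)\<close> lies in L2;
  therefore \<open>u\<close> vanishes on the strip
  (\<open>slice_eq_0_if_f12_eq_0\<close>).  Letting \<open>t \<rightarrow> 0\<close> gives \<open>u\<^sub>0 = 0\<close>, which contradicts the
  positivity of the initial momentum (\<open>generic_on_strip\<close>).

  The coefficients of the metric are polynomials in \<open>u\<close>, \<open>u\<^sub>x\<close> and \<open>u\<^sub>x\<^sub>x\<close>.  Their analyticity
  therefore follows once analytic functions are known to be closed under sums, products and
  \<open>\<partial>\<^sub>x\<close>; the derivative, obtained by differentiating a double power series termwise in one
  variable (\<open>double_power_series_deriv_snd\<close>), is the substantial case.\<close>

section \<open>Double power series\<close>

text \<open>Over the reals, unconditional and absolute summability coincide, so a product of two convergent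
  sums is absolutely summable over the product of the index sets and may be summed in any order.\<close>

lemma has_sum_product_real:
  fixes f :: "'a \<Rightarrow> real" and g :: "'b \<Rightarrow> real"
  assumes f: "(f has_sum a) A" and g: "(g has_sum b) B"
  shows "((\<lambda>(x, y). f x * g y) has_sum (a * b)) (A \<times> B)"
proof -
  have "(\<lambda>x. norm (f x)) summable_on A" and "(\<lambda>y. norm (g y)) summable_on B"
    using f g summable_on_iff_abs_summable_on_real has_sum_imp_summable by blast+
  then have "(\<lambda>(x, y). norm (f x) * norm (g y)) summable_on A \<times> B"
    by (intro summable_on_SigmaI[where g = "\<lambda>x. norm (f x) * (\<Sum>\<^sub>\<infinity>y\<in>B. norm (g y))"])
      (auto intro!: summable_on_cmult_left has_sum_cmult_right has_sum_infsum)
  then have "(\<lambda>(x, y). f x * g y) summable_on A \<times> B"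
    by (intro abs_summable_summable[of "\<lambda>(x, y). f x * g y"])
      (simp add: case_prod_unfold abs_mult)
  then obtain c where c: "((\<lambda>(x, y). f x * g y) has_sum c) (A \<times> B)"
    by (auto simp: summable_on_def)
  have "((\<lambda>x. f x * b) has_sum c) A"
    by (rule has_sum_Sigma'[OF c]) (use has_sum_cmult_right[OF g] in auto)
  moreover have "((\<lambda>x. f x * b) has_sum (a * b)) A"
    by (rule has_sum_cmult_left[OF f])
  ultimately have "c = a * b"
    by (rule has_sum_unique)
  with c show ?thesis by simp
qed

lemma bounded_Suc_mult_power:
  fixes q :: real
  assumes "0 \<le> q" "q < 1"
  obtains C where "\<And>n. real (Suc n) * q ^ n \<le> C"
proof -
  have "(\<lambda>n. real n * q ^ n + q ^ n) \<longlonglongrightarrow> 0 + 0"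
    using assms by (intro tendsto_add powser_times_n_limit_0 LIMSEQ_power_zero) auto
  then have "Bseq (\<lambda>n. real n * q ^ n + q ^ n)"
    by (intro convergent_imp_Bseq convergentI)
  then obtain C where "\<And>n. norm (real n * q ^ n + q ^ n) \<le> C"
    by (auto simp: Bseq_def)
  then have "real (Suc n) * q ^ n \<le> C" for n
    using order_trans[OF abs_ge_self] by (fastforce simp: algebra_simps)
  then show ?thesis by (rule that)
qed

lemma has_sum_swap_UNIV:
  "((\<lambda>(i, j). f i j) has_sum s) UNIV \<Longrightarrow> ((\<lambda>(j, i). f i j) has_sum s) (UNIV \<times> UNIV)"
  using has_sum_swap[where f = "\<lambda>(i, j). f i j" and S = s and A = UNIV and B = UNIV] by simp

text \<open>For a fixed value of the first variable the double series is, after summation over \<open>i\<close>, a power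
  series in the second variable, which may be differentiated termwise.  What remains is that the
  differentiated double series converges unconditionally, so that its iterated sum is its sum.
  This follows by comparison with the given series at some \<open>\<rho>\<close> between \<open>\<bar>k\<bar>\<close> and \<open>r\<close>: the
  geometric factor \<open>(\<bar>k\<bar> / \<rho>)\<^sup>j\<close> absorbs the factor \<open>j + 1\<close> produced by the derivative.\<close>

lemma double_power_series_deriv_snd:
  fixes a :: "nat \<times> nat \<Rightarrow> real"
  assumes a: "\<And>y. \<bar>y\<bar> < r \<Longrightarrow> ((\<lambda>(i, j). a (i, j) * h ^ i * y ^ j) has_sum f y) UNIV"
    and k: "\<bar>k\<bar> < r"
  obtains D where "(f has_real_derivative D) (at k)"
    and "((\<lambda>(i, j). (real (Suc j) * a (i, Suc j)) * h ^ i * k ^ j) has_sum D) UNIV"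
proof -
  define \<rho> where "\<rho> = (\<bar>k\<bar> + r) / 2"
  have \<rho>: "\<bar>k\<bar> < \<rho>" "\<rho> < r" "0 < \<rho>" using k by (auto simp: \<rho>_def)
  have sa: "(\<lambda>(i, j). \<bar>a (i, j) * h ^ i * \<rho> ^ j\<bar>) summable_on UNIV"
  proof -
    have "(\<lambda>(i, j). a (i, j) * h ^ i * \<rho> ^ j) summable_on UNIV"
      using a[of \<rho>] \<rho> by (auto simp: summable_on_def)
    then have "(\<lambda>x. norm (case x of (i, j) \<Rightarrow> a (i, j) * h ^ i * \<rho> ^ j)) summable_on UNIV"
      by (rule summable_on_iff_abs_summable_on_real[THEN iffD1])
    then show ?thesis
      by (simp add: case_prod_unfold)
  qed
  have col: "(\<lambda>i. a (i, j) * h ^ i) summable_on UNIV" for j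
  proof -
    have "(\<lambda>(j, i). a (i, j) * h ^ i * \<rho> ^ j) summable_on UNIV \<times> UNIV"
      using has_sum_swap_UNIV[OF a[of \<rho>]] \<rho> unfolding summable_on_def by auto
    then have "(\<lambda>i. a (i, j) * h ^ i * \<rho> ^ j) summable_on UNIV"
      by (rule summable_on_SigmaD1) simp
    then have "(\<lambda>i. a (i, j) * h ^ i * \<rho> ^ j * inverse (\<rho> ^ j)) summable_on UNIV"
      by (rule summable_on_cmult_left)
    then show ?thesis using \<rho> by (simp add: mult.assoc)
  qed
  define c where "c j = (\<Sum>\<^sub>\<infinity>i. a (i, j) * h ^ i)" for j
  have c: "((\<lambda>i. a (i, j) * h ^ i * y) has_sum (c j * y)) UNIV" for j y
    unfolding c_def by (intro has_sum_cmult_left has_sum_infsum col)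
  have sums: "(\<lambda>j. c j * y ^ j) sums f y" if "\<bar>y\<bar> < r" for y
  proof -
    have "((\<lambda>(j, i). a (i, j) * h ^ i * y ^ j) has_sum f y) (UNIV \<times> UNIV)"
      by (rule has_sum_swap_UNIV[OF a[OF that]])
    then have "((\<lambda>j. c j * y ^ j) has_sum f y) UNIV"
      by (rule has_sum_Sigma') (use c in auto)
    then show ?thesis by (rule has_sum_imp_sums)
  qed
  have der0: "((\<lambda>y. \<Sum>j. c j * y ^ j) has_real_derivative (\<Sum>j. diffs c j * k ^ j)) (at k)"
    by (rule termdiffs_strong'[where K = r]) (use sums k in \<open>auto simp: sums_iff\<close>)
  have der: "(f has_real_derivative (\<Sum>j. diffs c j * k ^ j)) (at k)"
  proof (rule has_field_derivative_transform_within_open[OF der0])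
    show "open {-r<..<r}" "k \<in> {-r<..<r}" using k by auto
    show "(\<Sum>j. c j * y ^ j) = f y" if "y \<in> {-r<..<r}" for y
      using sums[of y] that by (auto simp: sums_iff)
  qed
  obtain C where C: "\<And>n. real (Suc n) * (\<bar>k\<bar> / \<rho>) ^ n \<le> C"
    using bounded_Suc_mult_power[of "\<bar>k\<bar> / \<rho>"] \<rho> by auto
  have "(\<lambda>x. norm (case x of (i, j) \<Rightarrow> (real (Suc j) * a (i, Suc j)) * h ^ i * k ^ j))
      summable_on UNIV"
  proof (rule summable_on_comparison_test)
    have "(\<lambda>(i, j). \<bar>a (i, j) * h ^ i * \<rho> ^ j\<bar>) summable_on
        range (\<lambda>(i, j). (i, Suc j))"
      using sa by (rule summable_on_subset) simp
    then have "(\<lambda>(i, j). \<bar>a (i, Suc j) * h ^ i * \<rho> ^ Suc j\<bar>) summable_on UNIV"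
      by (subst (asm) summable_on_reindex) (auto simp: inj_on_def comp_def case_prod_unfold)
    then show "(\<lambda>x. C / \<rho> * (case x of (i, j) \<Rightarrow> \<bar>a (i, Suc j) * h ^ i * \<rho> ^ Suc j\<bar>)) summable_on UNIV"
      by (rule summable_on_cmult_right)
    fix x :: "nat \<times> nat"
    obtain i j where x: "x = (i, j)" by (cases x)
    have "norm ((real (Suc j) * a (i, Suc j)) * h ^ i * k ^ j)
        = (real (Suc j) * (\<bar>k\<bar> / \<rho>) ^ j) * (\<bar>a (i, Suc j) * h ^ i\<bar> * \<rho> ^ j)"
      using \<rho> by (simp add: abs_mult power_abs power_divide)
    also have "\<dots> \<le> C * (\<bar>a (i, Suc j) * h ^ i\<bar> * \<rho> ^ j)"
      using \<rho> by (intro mult_right_mono C) auto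
    also have "\<dots> = C / \<rho> * \<bar>a (i, Suc j) * h ^ i * \<rho> ^ Suc j\<bar>"
      using \<rho> by (simp add: abs_mult)
    finally show "norm (case x of (i, j) \<Rightarrow> (real (Suc j) * a (i, Suc j)) * h ^ i * k ^ j)
        \<le> C / \<rho> * (case x of (i, j) \<Rightarrow> \<bar>a (i, Suc j) * h ^ i * \<rho> ^ Suc j\<bar>)"
      by (simp only: x prod.case)
  qed simp
  then obtain D where D: "((\<lambda>(i, j). (real (Suc j) * a (i, Suc j)) * h ^ i * k ^ j) has_sum D) UNIV"
    using abs_summable_summable summable_on_def by blast
  then have "((\<lambda>(j, i). (real (Suc j) * a (i, Suc j)) * h ^ i * k ^ j) has_sum D) (UNIV \<times> UNIV)"
    by (rule has_sum_swap_UNIV)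
  then have "((\<lambda>j. diffs c j * k ^ j) has_sum D) UNIV"
  proof (rule has_sum_Sigma')
    fix j
    show "((\<lambda>i. case (j, i) of (j, i) \<Rightarrow> (real (Suc j) * a (i, Suc j)) * h ^ i * k ^ j) has_sum
        diffs c j * k ^ j) UNIV"
      using c[of "Suc j" "real (Suc j) * k ^ j"] by (simp add: diffs_def mult_ac)
  qed
  then have "(\<Sum>j. diffs c j * k ^ j) = D"
    by (intro sums_unique[symmetric] has_sum_imp_sums)
  with der D show ?thesis using that by simp
qed

section \<open>Real analytic functions of two variables\<close>

lemma real_analytic_at_const: "real_analytic_at (\<lambda>_. c) p"
proof -
  define a :: "nat \<times> nat \<Rightarrow> real" where "a = (\<lambda>x. if x = (0, 0) then c else 0)"
  have "((\<lambda>(i, j). a (i, j) * h ^ i * k ^ j) has_sum c) UNIV" for h k :: real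
  proof -
    have "((\<lambda>(i, j). a (i, j) * h ^ i * k ^ j) has_sum c) {(0, 0)}"
      using has_sum_finite[of "{(0, 0)}" "\<lambda>(i, j). a (i, j) * h ^ i * k ^ j"]
      by (simp add: a_def)
    also have "?this \<longleftrightarrow> ?thesis"
      by (rule has_sum_cong_neutral) (auto simp: a_def split: if_splits)
    finally show ?thesis .
  qed
  then show ?thesis
    unfolding real_analytic_at_def
    by (intro exI[of _ a] exI[of _ 1]) simp
qed

lemma real_analytic_at_add:
  assumes "real_analytic_at f p" "real_analytic_at g p"
  shows "real_analytic_at (\<lambda>q. f q + g q) p"
proof -
  obtain a r where r: "r > 0" and a: "\<And>h k. \<bar>h\<bar> < r \<Longrightarrow> \<bar>k\<bar> < r \<Longrightarrow>
      ((\<lambda>(i, j). a (i, j) * h ^ i * k ^ j) has_sum f (fst p + h, snd p + k)) UNIV"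
    using assms(1) unfolding real_analytic_at_def by blast
  obtain b r' where r': "r' > 0" and b: "\<And>h k. \<bar>h\<bar> < r' \<Longrightarrow> \<bar>k\<bar> < r' \<Longrightarrow>
      ((\<lambda>(i, j). b (i, j) * h ^ i * k ^ j) has_sum g (fst p + h, snd p + k)) UNIV"
    using assms(2) unfolding real_analytic_at_def by blast
  have "((\<lambda>(i, j). (a (i, j) + b (i, j)) * h ^ i * k ^ j) has_sum
      f (fst p + h, snd p + k) + g (fst p + h, snd p + k)) UNIV"
    if "\<bar>h\<bar> < min r r'" "\<bar>k\<bar> < min r r'" for h k
    using has_sum_add[OF a[of h k] b[of h k]] that
    by (simp add: case_prod_unfold distrib_right)
  then show ?thesis
    unfolding real_analytic_at_def
    by (intro exI[of _ "\<lambda>x. a x + b x"] exI[of _ "min r r'"]) (use r r' in simp)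
qed

lemma real_analytic_at_mult:
  assumes "real_analytic_at f p" "real_analytic_at g p"
  shows "real_analytic_at (\<lambda>q. f q * g q) p"
proof -
  obtain a r where r: "r > 0" and a: "\<And>h k. \<bar>h\<bar> < r \<Longrightarrow> \<bar>k\<bar> < r \<Longrightarrow>
      ((\<lambda>(i, j). a (i, j) * h ^ i * k ^ j) has_sum f (fst p + h, snd p + k)) UNIV"
    using assms(1) unfolding real_analytic_at_def by blast
  obtain b r' where r': "r' > 0" and b: "\<And>h k. \<bar>h\<bar> < r' \<Longrightarrow> \<bar>k\<bar> < r' \<Longrightarrow>
      ((\<lambda>(i, j). b (i, j) * h ^ i * k ^ j) has_sum g (fst p + h, snd p + k)) UNIV"
    using assms(2) unfolding real_analytic_at_def by blast
  \<comment> \<open>The coefficients of the Cauchy product.\<close>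
  define c where "c = (\<lambda>(n, m). \<Sum>(i, j)\<in>{..n} \<times> {..m}. a (i, j) * b (n - i, m - j))"
  have "((\<lambda>(n, m). c (n, m) * h ^ n * k ^ m) has_sum
      f (fst p + h, snd p + k) * g (fst p + h, snd p + k)) UNIV"
    if hk: "\<bar>h\<bar> < min r r'" "\<bar>k\<bar> < min r r'" for h k
  proof -
    let ?v = "f (fst p + h, snd p + k) * g (fst p + h, snd p + k)"
    let ?t = "\<lambda>(n, m) (i, j). (a (i, j) * b (n - i, m - j)) * h ^ n * k ^ m"
    let ?D = "Sigma (UNIV :: (nat \<times> nat) set) (\<lambda>(n, m). {..n} \<times> {..m})"
    have "((\<lambda>(x, y). (case x of (i, j) \<Rightarrow> a (i, j) * h ^ i * k ^ j) *
                    (case y of (i, j) \<Rightarrow> b (i, j) * h ^ i * k ^ j)) has_sum ?v) (UNIV \<times> UNIV)"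
      using hk by (intro has_sum_product_real a b) auto
    \<comment> \<open>Reorder the pairs of monomials by the exponents of their product.\<close>
    also have "?this \<longleftrightarrow> ((\<lambda>(x, y). ?t x y) has_sum ?v) ?D"
      by (rule has_sum_reindex_bij_witness
            [of _ "\<lambda>((n, m), (i, j)). ((i, j), (n - i, m - j))"
                  "\<lambda>((i, j), (k, l)). ((i + k, j + l), (i, j))"])
         (auto simp: power_add)
    finally have "((\<lambda>(x, y). ?t x y) has_sum ?v) ?D" .
    then show ?thesis
    proof (rule has_sum_Sigma')
      fix x :: "nat \<times> nat"
      obtain n m where x: "x = (n, m)" by (cases x)
      have "(?t x has_sum sum (?t x) ({..n} \<times> {..m})) ({..n} \<times> {..m})"
        by (rule has_sum_finite) simp
      then show "((\<lambda>y. case (x, y) of (x, y) \<Rightarrow> ?t x y) has_sum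
          (case x of (n, m) \<Rightarrow> c (n, m) * h ^ n * k ^ m)) (case x of (n, m) \<Rightarrow> {..n} \<times> {..m})"
        by (simp add: x c_def sum_distrib_right case_prod_unfold)
    qed
  qed
  then show ?thesis
    unfolding real_analytic_at_def
    by (intro exI[of _ c] exI[of _ "min r r'"]) (use r r' in simp)
qed

text \<open>The second part is what makes \<open>pdx\<close> usable in calculus: \<open>deriv\<close> is an actual derivative only
  where the function is differentiable.\<close>

lemma real_analytic_at_pdx:
  assumes "real_analytic_at f p"
  shows "real_analytic_at (pdx f) p"
    and "((\<lambda>y. f (fst p, y)) has_real_derivative pdx f p) (at (snd p))"
proof -
  obtain a r where r: "r > 0" and a: "\<And>h k. \<bar>h\<bar> < r \<Longrightarrow> \<bar>k\<bar> < r \<Longrightarrow>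
      ((\<lambda>(i, j). a (i, j) * h ^ i * k ^ j) has_sum f (fst p + h, snd p + k)) UNIV"
    using assms unfolding real_analytic_at_def by blast
  have *: "((\<lambda>(i, j). (real (Suc j) * a (i, Suc j)) * h ^ i * k ^ j) has_sum
            pdx f (fst p + h, snd p + k)) UNIV \<and>
          ((\<lambda>y. f (fst p + h, y)) has_real_derivative pdx f (fst p + h, snd p + k)) (at (snd p + k))"
    if h: "\<bar>h\<bar> < r" and k: "\<bar>k\<bar> < r" for h k
  proof -
    obtain D where D: "((\<lambda>y. f (fst p + h, snd p + y)) has_real_derivative D) (at k)"
      and sum: "((\<lambda>(i, j). (real (Suc j) * a (i, Suc j)) * h ^ i * k ^ j) has_sum D) UNIV"
      using double_power_series_deriv_snd[OF a[OF h] k] by blast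
    have "((\<lambda>y. f (fst p + h, y)) has_real_derivative D) (at (snd p + k))"
      using D DERIV_shift[of "\<lambda>y. f (fst p + h, y)" D k "snd p"] by (simp add: add.commute)
    moreover from this have "pdx f (fst p + h, snd p + k) = D"
      by (simp add: pdx_def DERIV_imp_deriv)
    ultimately show ?thesis using sum by simp
  qed
  show "real_analytic_at (pdx f) p"
    unfolding real_analytic_at_def
    by (intro exI[of _ "\<lambda>(i, j). real (Suc j) * a (i, Suc j)"] exI[of _ r]) (use r * in simp)
  show "((\<lambda>y. f (fst p, y)) has_real_derivative pdx f p) (at (snd p))"
    using *[of 0 0] r by simp
qed

lemma real_analytic_at_power2:
  "real_analytic_at f p \<Longrightarrow> real_analytic_at (\<lambda>q. (f q)\<^sup>2) p"
  unfolding power2_eq_square by (rule real_analytic_at_mult)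

lemma real_analytic_at_diff:
  assumes "real_analytic_at f p" "real_analytic_at g p"
  shows "real_analytic_at (\<lambda>q. f q - g q) p"
  using real_analytic_at_add[OF assms(1) real_analytic_at_mult[OF real_analytic_at_const[of "-1"] assms(2)]]
  by simp

text \<open>Analyticity is defined on squares, open sets are described by round balls; a square of half-width
  \<open>d / 2\<close> fits into the ball of radius \<open>d\<close>.\<close>

lemma real_analytic_at_cong_open:
  assumes "real_analytic_at F p" "open U" "p \<in> U" "\<And>q. q \<in> U \<Longrightarrow> F q = f q"
  shows "real_analytic_at f p"
proof -
  obtain a r where r: "r > 0" and a: "\<And>h k. \<bar>h\<bar> < r \<Longrightarrow> \<bar>k\<bar> < r \<Longrightarrow>
      ((\<lambda>(i, j). a (i, j) * h ^ i * k ^ j) has_sum F (fst p + h, snd p + k)) UNIV"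
    using assms(1) unfolding real_analytic_at_def by blast
  obtain d where d: "d > 0" "ball p d \<subseteq> U"
    using assms(2,3) openE by blast
  have "(fst p + h, snd p + k) \<in> U" if "\<bar>h\<bar> < d / 2" "\<bar>k\<bar> < d / 2" for h k
  proof -
    have "dist p (fst p + h, snd p + k) = sqrt (h\<^sup>2 + k\<^sup>2)"
      by (cases p) (simp add: dist_prod_def dist_real_def)
    also have "\<dots> \<le> \<bar>h\<bar> + \<bar>k\<bar>"
      by (rule sqrt_sum_squares_le_sum_abs)
    finally show ?thesis using that d by (auto simp: subset_iff)
  qed
  then show ?thesis
    unfolding real_analytic_at_def using a d r assms(4)
    by (intro exI[of _ a] exI[of _ "min r (d / 2)"]) fastforce
qed

lemma real_analytic_on_open_iff:
  assumes "open S"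
  shows "real_analytic_on f S \<longleftrightarrow> (\<forall>p\<in>S. real_analytic_at f p)"
proof
  assume "real_analytic_on f S"
  then show "\<forall>p\<in>S. real_analytic_at f p"
    unfolding real_analytic_on_def using real_analytic_at_cong_open[OF _ assms] by blast
next
  assume "\<forall>p\<in>S. real_analytic_at f p"
  then show "real_analytic_on f S"
    unfolding real_analytic_on_def using assms by blast
qed

section \<open>Integrable solutions of a linear differential equation\<close>

lemma has_real_derivative_proportional_imp:
  fixes v :: "real \<Rightarrow> real"
  assumes "\<And>x. (v has_real_derivative c * v x) (at x)"
  shows "v x = v 0 * exp (c * x)"
proof -
  have "((\<lambda>x. v x * exp (- (c * x))) has_real_derivative 0) (at x)" for x
    by (auto intro!: derivative_eq_intros assms)
  then have "v x * exp (- (c * x)) = v 0 * exp (- (c * 0))"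
    by (intro DERIV_isconst_all) blast
  then show ?thesis by (simp add: exp_minus field_simps)
qed

text \<open>If \<open>w x > 0\<close>, then monotonicity gives \<open>w \<ge> w x\<close> on a whole half-line, hence on intervals of
  every length \<open>L\<close>, so that \<open>L * w x\<close> is bounded by the integral of \<open>w\<close> for all \<open>L\<close>.\<close>

lemma integrable_nonneg_mono_or_antimono_eq_0:
  fixes w :: "real \<Rightarrow> real"
  assumes int: "integrable lborel w" and nonneg: "\<And>x. w x \<ge> 0" and "mono w \<or> antimono w"
  shows "w x = 0"
proof (rule ccontr)
  assume "w x \<noteq> 0"
  with nonneg[of x] have pos: "w x > 0" by simp
  \<comment> \<open>This length makes \<open>L * w x\<close> exceed the integral by \<open>w x\<close>.\<close>
  define L where "L = integral\<^sup>L lborel w / w x + 1"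
  have "integral\<^sup>L lborel w \<ge> 0"
    using nonneg by (intro Bochner_Integration.integral_nonneg) auto
  then have L: "L > 0"
    using pos by (simp add: L_def add_nonneg_pos)
  obtain b where b: "\<And>y. y \<in> {b..b + L} \<Longrightarrow> w x \<le> w y"
  proof (cases "mono w")
    case True
    then show ?thesis by (intro that[of x]) (auto simp: mono_def)
  next
    case False
    with assms(3) show ?thesis by (intro that[of "x - L"]) (auto simp: antimono_def)
  qed
  have "(\<integral>y. indicat_real {b..b + L} y * w x \<partial>lborel) \<le> integral\<^sup>L lborel w"
  proof (rule integral_mono)
    show "integrable lborel (\<lambda>y. indicat_real {b..b + L} y * w x)"
      using L by (intro integrable_mult_left) (simp add: integrable_indicator_iff)
    show "indicat_real {b..b + L} y * w x \<le> w y" for y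
      using b[of y] nonneg[of y] by (auto simp: indicator_def)
  qed (rule int)
  then have "L * w x \<le> integral\<^sup>L lborel w"
    using L by simp
  then show False
    using pos by (simp add: L_def distrib_right)
qed

text \<open>The solutions of \<open>w'' = c w'\<close> have a derivative of constant sign, so they are monotone; this
  argument covers all values of \<open>c\<close> without solving for \<open>w\<close>.\<close>

lemma integrable_nonneg_eq_0_if_deriv2_proportional:
  fixes w v :: "real \<Rightarrow> real"
  assumes int: "integrable lborel w" and nonneg: "\<And>x. w x \<ge> 0"
    and w: "\<And>x. (w has_real_derivative v x) (at x)"
    and v: "\<And>x. (v has_real_derivative c * v x) (at x)"
  shows "w x = 0"
proof (rule integrable_nonneg_mono_or_antimono_eq_0[OF int nonneg])
  have v_eq: "v x = v 0 * exp (c * x)" for x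
    by (rule has_real_derivative_proportional_imp) (rule v)
  show "mono w \<or> antimono w"
  proof (cases "v 0 \<ge> 0")
    case True
    then have "v x \<ge> 0" for x by (subst v_eq) simp
    then have "mono w" unfolding mono_def
      by (metis DERIV_nonneg_imp_nondecreasing w)
    then show ?thesis ..
  next
    case False
    then have "v x \<le> 0" for x by (subst v_eq) (simp add: mult_nonpos_nonneg)
    then have "antimono w" unfolding antimono_def
      by (metis DERIV_nonpos_imp_nonincreasing w)
    then show ?thesis ..
  qed
qed

section \<open>Nongeneric solutions vanish\<close>

text \<open>The function \<open>f12\<close> equals \<open>(2 / m\<^sub>1) w\<^sub>x - w\<^sub>x\<^sub>x\<close> for \<open>w = u\<^sup>2\<close>.\<close>

lemma slice_eq_0_if_f12_eq_0:
  assumes L2: "(\<lambda>x. u (t, x)) \<in> L2_real"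
    and an: "\<And>x. real_analytic_at u (t, x)"
    and f12: "\<And>x. f12 m\<^sub>1 u (t, x) = 0"
  shows "u (t, x) = 0"
proof -
  have d1: "((\<lambda>y. u (t, y)) has_real_derivative pdx u (t, x)) (at x)" for x
    using real_analytic_at_pdx(2)[OF an[of x]] by simp
  have d2: "((\<lambda>y. pdx u (t, y)) has_real_derivative pdx (pdx u) (t, x)) (at x)" for x
    using real_analytic_at_pdx(2)[OF real_analytic_at_pdx(1)[OF an[of x]]] by simp
  have "(u (t, x))\<^sup>2 = 0"
  proof (rule integrable_nonneg_eq_0_if_deriv2_proportional
      [where w = "\<lambda>x. (u (t, x))\<^sup>2" and v = "\<lambda>x. 2 * u (t, x) * pdx u (t, x)" and c = "2 / m\<^sub>1"])
    show "integrable lborel (\<lambda>x. (u (t, x))\<^sup>2)"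
      using L2 by (simp add: L2_real_def)
    fix x
    show "((\<lambda>x. (u (t, x))\<^sup>2) has_real_derivative 2 * u (t, x) * pdx u (t, x)) (at x)"
      by (auto intro!: derivative_eq_intros d1)
    have "2 * u (t, x) * pdx (pdx u) (t, x) + 2 * (pdx u (t, x))\<^sup>2
        = 2 / m\<^sub>1 * (2 * u (t, x) * pdx u (t, x))"
      using f12[of x] by (simp add: f12_def algebra_simps power2_eq_square)
    then show "((\<lambda>x. 2 * u (t, x) * pdx u (t, x)) has_real_derivative
        2 / m\<^sub>1 * (2 * u (t, x) * pdx u (t, x))) (at x)"
      by (auto intro!: derivative_eq_intros d1 d2 simp: power2_eq_square algebra_simps)
  qed simp
  then show ?thesis by simp
qed

text \<open>The form \<open>omega2\<close> is \<open>\<mu>\<close> times \<open>omega1\<close> plus a constant multiple of \<open>dx\<close>, and only that last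
  term contributes.\<close>

lemma wedge_omega:
  "wedge (omega1 m\<^sub>1 u) (omega2 \<mu> m\<^sub>1 \<delta> u) p v w
    = - \<delta> * m\<^sub>1 * sqrt (1 + \<mu>\<^sup>2) * f12 m\<^sub>1 u p * (dx v * dt w - dx w * dt v)"
  unfolding wedge_def omega1_def omega2_def f21_def f22_def f11_def
  by (simp add: algebra_simps)

lemma nongeneric_on_iff_f12:
  assumes "m\<^sub>1 \<noteq> 0" "\<delta> \<noteq> 0"
  shows "nongeneric_on \<mu> m\<^sub>1 \<delta> u S \<longleftrightarrow> (\<forall>p\<in>S. f12 m\<^sub>1 u p = 0)"
proof
  assume *: "nongeneric_on \<mu> m\<^sub>1 \<delta> u S"
  have "sqrt (1 + \<mu>\<^sup>2) \<noteq> 0"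
    by (simp add: add_nonneg_eq_0_iff)
  show "\<forall>p\<in>S. f12 m\<^sub>1 u p = 0"
  proof
    fix p assume "p \<in> S"
    with * have "wedge (omega1 m\<^sub>1 u) (omega2 \<mu> m\<^sub>1 \<delta> u) p (0, 1) (1, 0) = 0"
      unfolding nongeneric_on_def by blast
    then show "f12 m\<^sub>1 u p = 0"
      using assms \<open>sqrt (1 + \<mu>\<^sup>2) \<noteq> 0\<close> by (simp add: wedge_omega dx_def dt_def)
  qed
qed (simp add: nongeneric_on_def wedge_omega)

lemma induced_metric_eq:
  "induced_metric \<mu> m\<^sub>1 \<delta> u p = quadratic_metric
     (\<lambda>p. (f11 u p)\<^sup>2 + (\<mu> * f11 u p + \<delta> * m\<^sub>1 * sqrt (1 + \<mu>\<^sup>2))\<^sup>2)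
     (\<lambda>p. f12 m\<^sub>1 u p * ((1 + \<mu>\<^sup>2) * f11 u p + \<delta> * m\<^sub>1 * \<mu> * sqrt (1 + \<mu>\<^sup>2)))
     (\<lambda>p. (1 + \<mu>\<^sup>2) * (f12 m\<^sub>1 u p)\<^sup>2) p"
proof (intro ext)
  fix v w
  define q where "q = \<delta> * m\<^sub>1 * sqrt (1 + \<mu>\<^sup>2)"
  have q: "\<delta> * m\<^sub>1 * \<mu> * sqrt (1 + \<mu>\<^sup>2) = \<mu> * q"
    by (simp add: q_def)
  have f21: "f21 \<mu> m\<^sub>1 \<delta> u p = \<mu> * f11 u p + q"
    by (simp add: f21_def f11_def q_def)
  show "induced_metric \<mu> m\<^sub>1 \<delta> u p v w = quadratic_metric
     (\<lambda>p. (f11 u p)\<^sup>2 + (\<mu> * f11 u p + \<delta> * m\<^sub>1 * sqrt (1 + \<mu>\<^sup>2))\<^sup>2)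
     (\<lambda>p. f12 m\<^sub>1 u p * ((1 + \<mu>\<^sup>2) * f11 u p + \<delta> * m\<^sub>1 * \<mu> * sqrt (1 + \<mu>\<^sup>2)))
     (\<lambda>p. (1 + \<mu>\<^sup>2) * (f12 m\<^sub>1 u p)\<^sup>2) p v w"
    unfolding induced_metric_def quadratic_metric_def omega1_def omega2_def f22_def f21 q
      q_def[symmetric]
    by (simp add: algebra_simps power2_eq_square)
qed

text \<open>For a nongeneric solution every slice with \<open>0 < t < \<epsilon>\<close> is zero, and the one-sided time
  derivative at \<open>t = 0\<close> carries this to the initial value by continuity.\<close>

lemma generic_on_strip:
  assumes sol: "global_solution s u\<^sub>0 u"
    and an: "\<And>p. p \<in> {0<..<\<epsilon>} \<times> UNIV \<Longrightarrow> real_analytic_at u p"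
    and u\<^sub>0: "u\<^sub>0 x \<noteq> 0" and "m\<^sub>1 \<noteq> 0" "\<delta> \<noteq> 0" "\<epsilon> > 0"
  shows "generic_on \<mu> m\<^sub>1 \<delta> u ({0<..<\<epsilon>} \<times> UNIV)"
proof (rule ccontr)
  assume "\<not> ?thesis"
  then have "\<forall>p\<in>{0<..<\<epsilon>} \<times> UNIV. f12 m\<^sub>1 u p = 0"
    unfolding generic_on_def using nongeneric_on_iff_f12[OF assms(4,5)] by simp
  then have f12: "f12 m\<^sub>1 u (t, x) = 0" if "0 < t" "t < \<epsilon>" for t x
    using that by simp
  have zero: "u (t, x) = 0" if t: "0 < t" "t < \<epsilon>" for t
  proof (rule slice_eq_0_if_f12_eq_0)
    have "(\<lambda>x. u (t, x)) \<in> sobolev_space s"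
      using sol t unfolding global_solution_def by simp
    then show "(\<lambda>x. u (t, x)) \<in> L2_real"
      by (simp add: sobolev_space_def gevrey_space_def)
  qed (use t an f12 in auto)
  obtain d where "((\<lambda>\<tau>. u (\<tau>, x)) has_real_derivative d) (at 0 within {0..})"
    using sol unfolding global_solution_def by blast
  then have "((\<lambda>\<tau>. u (\<tau>, x)) \<longlongrightarrow> u (0, x)) (at 0 within {0..})"
    using DERIV_continuous continuous_within by blast
  then have "((\<lambda>\<tau>. u (\<tau>, x)) \<longlongrightarrow> u (0, x)) (at_right 0)"
    by (rule tendsto_within_subset) auto
  moreover have "((\<lambda>\<tau>. u (\<tau>, x)) \<longlongrightarrow> 0) (at_right 0)"
    by (intro tendsto_eventually eventually_at_rightI[OF _ \<open>\<epsilon> > 0\<close>]) (simp add: zero)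
  ultimately have "u (0, x) = 0"
    using tendsto_unique trivial_limit_at_right_real by blast
  moreover have "u (0, x) = u\<^sub>0 x"
    using sol unfolding global_solution_def by blast
  ultimately show False using u\<^sub>0 by simp
qed

theorem theorem1p2:
  fixes s \<mu> m\<^sub>1 \<delta> \<epsilon> :: real
    and u\<^sub>0 :: "real \<Rightarrow> real"
    and u :: "real \<times> real \<Rightarrow> real"
  assumes "s > 3 / 2"
    and "u\<^sub>0 \<in> gevrey_space 1 s"
    and "integrable lborel (momentum u\<^sub>0)"
    and "\<forall>x. momentum u\<^sub>0 x > 0"
    and "global_solution s u\<^sub>0 u"
    and "real_analytic_on u ({0..} \<times> UNIV)"
    and "m\<^sub>1 \<in> {-2, 1}"
    and "\<delta> \<in> {1, -1}"
    and "\<epsilon> > 0"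
  shows "let S = {0<..<\<epsilon>} \<times> (UNIV :: real set);
             m = (\<lambda>p. u p - pdx (pdx u) p);
             \<psi> = (\<lambda>p. 4 / m\<^sub>1 * u p * pdx u p - 2 * (pdx u p)\<^sup>2 - 2 * (u p)\<^sup>2);
             E = (\<lambda>p. (m p)\<^sup>2 + (\<mu> * m p + \<delta> * m\<^sub>1 * sqrt (1 + \<mu>\<^sup>2))\<^sup>2);
             F = (\<lambda>p. (2 * u p * m p + \<psi> p) *
                      ((1 + \<mu>\<^sup>2) * m p + \<delta> * m\<^sub>1 * \<mu> * sqrt (1 + \<mu>\<^sup>2)));
             G = (\<lambda>p. (1 + \<mu>\<^sup>2) * (2 * u p * m p + \<psi> p)\<^sup>2)
         in generic_on \<mu> m\<^sub>1 \<delta> u S \<and>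
            (\<forall>p\<in>S. induced_metric \<mu> m\<^sub>1 \<delta> u p = quadratic_metric E F G p) \<and>
            real_analytic_on E S \<and> real_analytic_on F S \<and> real_analytic_on G S"
proof -
  let ?S = "{0<..<\<epsilon>} \<times> (UNIV :: real set)"
  have S: "open ?S"
    by (intro open_Times) auto
  have "real_analytic_on u ?S"
    using assms(6) unfolding real_analytic_on_def by fastforce
  then have an: "real_analytic_at u p" if "p \<in> ?S" for p
    using that real_analytic_on_open_iff[OF S] by blast
  have "u\<^sub>0 \<noteq> (\<lambda>_. 0)"
    using assms(4) by (auto simp: momentum_def)
  then obtain x where "u\<^sub>0 x \<noteq> 0" by blast
  then have gen: "generic_on \<mu> m\<^sub>1 \<delta> u ?S"
    using assms(7-9) by (intro generic_on_strip[OF assms(5) an]) auto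
  have f12: "2 * u p * f11 u p +
      (4 / m\<^sub>1 * u p * pdx u p - 2 * (pdx u p)\<^sup>2 - 2 * (u p)\<^sup>2) = f12 m\<^sub>1 u p" for p
    by (simp add: f11_def f12_def)
  note f11 = f11_def[symmetric]
  have pdx: "real_analytic_at (pdx u) p" "real_analytic_at (pdx (pdx u)) p" if "p \<in> ?S" for p
    using real_analytic_at_pdx(1) an that by blast+
  have f: "real_analytic_at (f11 u) p" "real_analytic_at (f12 m\<^sub>1 u) p" if "p \<in> ?S" for p
    unfolding f11_def [abs_def] f12_def [abs_def]
    by (intro real_analytic_at_add real_analytic_at_diff real_analytic_at_mult
          real_analytic_at_power2 real_analytic_at_const an pdx that)+
  show ?thesis
    unfolding Let_def f11 f12 real_analytic_on_open_iff[OF S]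
    by (intro conjI ballI gen induced_metric_eq real_analytic_at_add real_analytic_at_mult
          real_analytic_at_power2 real_analytic_at_const f)
qed

end
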